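(* Let $a$ be a real number with $-1/3<a<0$, and for each prime power $q$ let $p=q^{a}$ and let $Q_p\subseteq\mathbb F_q^2$ be a $p$-random set. Let $f:\mathbb R\to\mathbb R$ be any function with $\lim_{q\to\infty}f(q)=\infty$. Then \[ \lim_{q\to\infty}\mathbb P\big[a(Q_p)\ge qpf(q)\big]=0, \] where the limit is over prime powers $q$.
   Context: $\mathbb F_q$ is the finite field with $q$ elements. An arc in $\mathbb F_q^2$ is a set of points no three of which lie on a common line. For $P\subseteq\mathbb F_q^2$, $a(P)$ denotes the maximum size of an arc $P'\subseteq P$. A $p$-random set $Q_p\subseteq\mathbb F_q^2$ is a random subset in which each point $x\in\mathbb F_q^2$ is included independently with probability $p$. *)

theory Defs
  imports "HOL-Probability.Probability" "HOL-Algebra.Ring" "HOL-Number_Theory.Prime_Powers"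
begin

definition plane :: "('a, 'm) ring_scheme \<Rightarrow> ('a \<times> 'a) set" where
  "plane F = carrier F \<times> carrier F"

definition line_of :: "('a, 'm) ring_scheme \<Rightarrow> 'a \<Rightarrow> 'a \<Rightarrow> 'a \<Rightarrow> ('a \<times> 'a) set" where
  "line_of F u v w = {(x, y) \<in> plane F. u \<otimes>\<^bsub>F\<^esub> x \<oplus>\<^bsub>F\<^esub> v \<otimes>\<^bsub>F\<^esub> y = w}"

definition lines :: "('a, 'm) ring_scheme \<Rightarrow> ('a \<times> 'a) set set" where
  "lines F = {line_of F u v w | u v w. u \<in> carrier F \<and> v \<in> carrier F \<and> w \<in> carrier F
                \<and> \<not> (u = \<zero>\<^bsub>F\<^esub> \<and> v = \<zero>\<^bsub>F\<^esub>)}"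

definition arc_in :: "('a, 'm) ring_scheme \<Rightarrow> ('a \<times> 'a) set \<Rightarrow> bool" where
  "arc_in F S \<longleftrightarrow> S \<subseteq> plane F \<and>
     (\<forall>x\<in>S. \<forall>y\<in>S. \<forall>z\<in>S. x \<noteq> y \<and> y \<noteq> z \<and> x \<noteq> z \<longrightarrow>
        \<not> (\<exists>l\<in>lines F. x \<in> l \<and> y \<in> l \<and> z \<in> l))"

definition max_arc :: "('a, 'm) ring_scheme \<Rightarrow> ('a \<times> 'a) set \<Rightarrow> nat" where
  "max_arc F P = Max {card S | S. S \<subseteq> P \<and> arc_in F S}"

(* Distribution of the random subset of the finite set A that contains each element
   of A independently with probability p; only meaningful for p in [0,1]. *)
definition random_subset :: "'b set \<Rightarrow> real \<Rightarrow> 'b set pmf" where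
  "random_subset A p = map_pmf (\<lambda>b. {x \<in> A. b x}) (Pi_pmf A False (\<lambda>_. bernoulli_pmf p))"

end

theory Submission
  imports Defs "HOL-Real_Asymp.Real_Asymp"
begin

text \<open>
  Fix a set \<open>B\<close> of about \<open>sqrt q\<close> points of an arc \<open>A\<close> and join two points of the plane when some
  point of \<open>B\<close> lies on the line through them; then \<open>A - B\<close> is independent in this graph. Counting the
  pairs of a point set \<open>U\<close> collinear with a given point of \<open>B\<close> by Cauchy-Schwarz over the \<open>q + 1\<close>
  directions, and using that every line meets \<open>B\<close> in at most two points, any \<open>U\<close> with more than
  \<open>2 (q + 1)\<close> points has a vertex adjacent to a fraction \<open>card B / (4 (q + 1))\<close> of \<open>U\<close>.
  Branching repeatedly on such a vertex covers all independent sets by \<open>exp (O(sqrt q (ln q)^2))\<close>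
  containers of size \<open>O(q)\<close>. Each container meets the random set in more than a large multiple of
  \<open>q p\<close> points with probability at most \<open>exp (- 2 q p)\<close>, say, and \<open>q p \<ge> q powr (2 / 3)\<close> beats the
  number of pairs of a set \<open>B\<close> and a container.
\<close>

section \<open>Containers for independent sets\<close>

text \<open>Induction on the size of \<open>V\<close>. If the chosen vertex \<open>v\<close> lies in
  \<open>I\<close>, its neighbours are excluded and the vertex set shrinks at least by the factor
  \<open>1 - d\<close>; otherwise only \<open>v\<close> is dropped. The number \<open>j\<close> is a
  budget for moves of the first kind: after \<open>j\<close> of them at most \<open>K\<close>
  vertices are left, and they put at most \<open>j\<close> extra vertices into a container.\<close>

lemma container_family:
  fixes E :: "'b \<Rightarrow> 'b \<Rightarrow> bool" and K d :: real
  assumes "finite V" and "0 \<le> d" "d \<le> 1"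
    and deg: "\<And>U. U \<subseteq> V \<Longrightarrow> real (card U) > K \<Longrightarrow>
                \<exists>v\<in>U. real (card {y \<in> U. y \<noteq> v \<and> E v y}) \<ge> d * card U"
    and "(1 - d) ^ j * card V \<le> K"
  shows "\<exists>\<C>. finite \<C> \<and> card \<C> \<le> (card V + 1) ^ j \<and> (\<forall>C\<in>\<C>. C \<subseteq> V \<and> real (card C) \<le> K + j) \<and>
           (\<forall>I\<subseteq>V. (\<forall>x\<in>I. \<forall>y\<in>I. x \<noteq> y \<longrightarrow> \<not> E x y) \<longrightarrow> (\<exists>C\<in>\<C>. I \<subseteq> C))"
  using assms
proof (induction "card V" arbitrary: V j rule: less_induct)
  case less
  let ?ind = "\<lambda>I. \<forall>x\<in>I. \<forall>y\<in>I. x \<noteq> y \<longrightarrow> \<not> E x y"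
  show ?case
  proof (cases "real (card V) \<le> K")
    case True
    show ?thesis
      by (rule exI[of _ "{V}"]) (use True in auto)
  next
    case False
    \<comment> \<open>For \<open>j = 0\<close> the last hypothesis would read
      \<open>card V \<le> K\<close>, so some budget is left.\<close>
    then obtain k where k: "j = Suc k"
      using less.prems(5) by (cases j) auto
    \<comment> \<open>An independent set either avoids \<open>v\<close> or contains \<open>v\<close> and avoids its neighbours.\<close>
    obtain v where v: "v \<in> V" "real (card {y \<in> V. y \<noteq> v \<and> E v y}) \<ge> d * card V"
      using less.prems(4)[of V] False by auto
    define N where "N = {y \<in> V. y \<noteq> v \<and> E v y}"
    define V1 where "V1 = V - {v} - N"
    define V2 where "V2 = V - {v}"
    note fin = \<open>finite V\<close>
    have sub: "V1 \<subseteq> V" "V2 \<subseteq> V" "V1 \<subseteq> V2" "finite V1" "finite V2" "finite N"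
      using fin by (auto simp: V1_def V2_def N_def)
    have c2: "card V = Suc (card V2)"
      unfolding V2_def using v fin by (metis card_Suc_Diff1)
    have "card V1 \<le> card V2"
      using sub by (intro card_mono) auto
    with c2 have lt: "card V1 < card V" "card V2 < card V" by auto
    have "card V1 \<le> card (V - N)"
      using fin by (intro card_mono) (auto simp: V1_def)
    also have "card (V - N) = card V - card N"
      by (rule card_Diff_subset) (use sub in \<open>auto simp: N_def\<close>)
    finally have "real (card V1) \<le> real (card V) - real (card N)"
      using card_mono[OF fin, of N] unfolding N_def by (auto simp: of_nat_diff)
    also have "\<dots> \<le> (1 - d) * card V"
      using v(2) by (simp add: N_def algebra_simps)
    finally have V1: "real (card V1) \<le> (1 - d) * card V" .
    have "(1 - d) ^ k * card V1 \<le> (1 - d) ^ k * ((1 - d) * card V)"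
      by (rule mult_left_mono[OF V1]) (use \<open>d \<le> 1\<close> in auto)
    also have "\<dots> \<le> K" using less.prems(5) k by (simp add: mult_ac)
    finally have K1: "(1 - d) ^ k * card V1 \<le> K" .
    \<comment> \<open>Dropping \<open>v\<close> alone spends no budget: \<open>V2\<close> keeps the
      exponent \<open>j\<close>, while \<open>V1\<close> has \<open>k\<close>.\<close>
    have "(1 - d) ^ j * card V2 \<le> (1 - d) ^ j * card V"
      by (rule mult_left_mono) (use \<open>d \<le> 1\<close> lt in auto)
    with less.prems(5) have K2: "(1 - d) ^ j * card V2 \<le> K" by linarith
    have IH: "\<exists>\<C>. finite \<C> \<and> card \<C> \<le> (card W + 1) ^ i \<and>
        (\<forall>C\<in>\<C>. C \<subseteq> W \<and> real (card C) \<le> K + i) \<and> (\<forall>I\<subseteq>W. ?ind I \<longrightarrow> (\<exists>C\<in>\<C>. I \<subseteq> C))"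
      if "W \<subseteq> V" "card W < card V" "(1 - d) ^ i * card W \<le> K" for W i
      by (rule less.hyps[OF that(2)])
        (use that less.prems finite_subset[OF that(1)] in \<open>auto intro: less.prems(4)\<close>)
    obtain C1 where C1: "finite C1" "card C1 \<le> (card V1 + 1) ^ k"
      "\<forall>C\<in>C1. C \<subseteq> V1 \<and> real (card C) \<le> K + k" "\<forall>I\<subseteq>V1. ?ind I \<longrightarrow> (\<exists>C\<in>C1. I \<subseteq> C)"
      using IH[OF sub(1) lt(1) K1] by (elim exE conjE) (rule that)
    obtain C2 where C2: "finite C2" "card C2 \<le> (card V2 + 1) ^ j"
      "\<forall>C\<in>C2. C \<subseteq> V2 \<and> real (card C) \<le> K + j" "\<forall>I\<subseteq>V2. ?ind I \<longrightarrow> (\<exists>C\<in>C2. I \<subseteq> C)"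
      using IH[OF sub(2) lt(2) K2] by (elim exE conjE) (rule that)
    \<comment> \<open>Putting \<open>v\<close> back raises the size bound from \<open>K + k\<close>
      to \<open>K + j\<close>.\<close>
    define \<C> where "\<C> = insert v ` C1 \<union> C2"
    have "card \<C> \<le> card (insert v ` C1) + card C2"
      unfolding \<C>_def by (rule card_Un_le)
    also have "\<dots> \<le> card C1 + card C2"
      using card_image_le[OF C1(1)] by simp
    also have "\<dots> \<le> card V ^ k + card V ^ j"
      using C1(2) C2(2) power_mono[of "card V1 + 1" "card V" k] lt(1) c2 by auto
    \<comment> \<open>The recursion for the number of containers closes because
      \<open>n ^ k + n ^ Suc k = n ^ k * (n + 1)\<close> with \<open>n = card V\<close>.\<close>
    also have "\<dots> = card V ^ k * (card V + 1)"
      by (simp add: k)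
    also have "\<dots> \<le> (card V + 1) ^ k * (card V + 1)"
      by (intro mult_right_mono power_mono) auto
    also have "\<dots> = (card V + 1) ^ j"
      by (simp add: k)
    finally have card: "card \<C> \<le> (card V + 1) ^ j" .
    have mem: "C \<subseteq> V \<and> real (card C) \<le> K + j" if "C \<in> \<C>" for C
      using that unfolding \<C>_def
    proof
      assume "C \<in> insert v ` C1"
      then obtain C' where C': "C = insert v C'" "C' \<in> C1" by auto
      have "finite C'" using C1(3) C'(2) sub(4) finite_subset by blast
      then have "card C \<le> Suc (card C')" using C'(1) by (simp add: card_insert_if)
      then show ?thesis using C1(3) C' v(1) sub(1) k by fastforce
    next
      assume "C \<in> C2"
      then show ?thesis using C2(3) sub(2) by auto
    qed
    have cover: "\<exists>C\<in>\<C>. I \<subseteq> C" if I: "I \<subseteq> V" "?ind I" for I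
    proof (cases "v \<in> I")
      case True
      have "I - {v} \<subseteq> V1" using I True by (auto simp: V1_def N_def)
      moreover have "?ind (I - {v})" using I by auto
      ultimately obtain C where C: "C \<in> C1" "I - {v} \<subseteq> C"
        using spec[OF C1(4), of "I - {v}"] by auto
      show ?thesis
        by (rule bexI[of _ "insert v C"]) (use C in \<open>auto simp: \<C>_def\<close>)
    next
      case False
      then have "I \<subseteq> V2" using I by (auto simp: V2_def)
      then have "\<exists>C\<in>C2. I \<subseteq> C" using spec[OF C2(4), of I] I(2) by simp
      then show ?thesis by (auto simp: \<C>_def)
    qed
    have "finite \<C>" using C1(1) C2(1) by (simp add: \<C>_def)
    then show ?thesis
      using card mem cover by (intro exI[of _ \<C>]) simp
  qed
qed

section \<open>Counting pairs in a common fibre\<close>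

text \<open>The right-hand side counts ordered pairs of distinct points in a common fibre, which is
  the sum of the squared fibre sizes minus \<open>card U\<close>. Cauchy-Schwarz bounds the sum of
  squares from below.\<close>

lemma card_fiber_pairs_ge:
  fixes g :: "'b \<Rightarrow> 'c"
  assumes "finite U" "finite T" "g ` U \<subseteq> T" "T \<noteq> {}"
  shows "real (card U) ^ 2 / card T - card U \<le> (\<Sum>x\<in>U. real (card {y \<in> U. y \<noteq> x \<and> g y = g x}))"
proof -
  define n where "n = (\<lambda>t. real (card {y \<in> U. g y = t}))"
  have n: "real (card {y \<in> U. y \<noteq> x \<and> g y = g x}) = n (g x) - 1" if "x \<in> U" for x
  proof -
    have "{y \<in> U. g y = g x} = insert x {y \<in> U. y \<noteq> x \<and> g y = g x}"
      using that by auto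
    then have "card {y \<in> U. g y = g x} = Suc (card {y \<in> U. y \<noteq> x \<and> g y = g x})"
      using assms(1) by simp
    then show ?thesis by (simp add: n_def)
  qed
  \<comment> \<open>Used with \<open>h = 1\<close> to express \<open>card U\<close> and with
    \<open>h = n\<close> to obtain the sum of squares.\<close>
  have sum_fibers: "(\<Sum>x\<in>U. h (g x)) = (\<Sum>t\<in>T. n t * h t)" for h :: "'c \<Rightarrow> real"
  proof -
    have "(\<Sum>x\<in>U. h (g x)) = (\<Sum>t\<in>T. \<Sum>x\<in>{x\<in>U. g x = t}. h (g x))"
      by (rule sum.group[symmetric]) (use assms in auto)
    also have "\<dots> = (\<Sum>t\<in>T. n t * h t)"
      by (intro sum.cong) (auto simp: n_def)
    finally show ?thesis .
  qed
  have "real (card U) = (\<Sum>t\<in>T. n t * 1)"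
    using sum_fibers[of "\<lambda>_. 1"] by simp
  then have "real (card U) ^ 2 \<le> (\<Sum>t\<in>T. (n t)\<^sup>2) * (\<Sum>t\<in>T. 1\<^sup>2)"
    using Cauchy_Schwarz_ineq_sum[of n "\<lambda>_. 1" T] by simp
  also have "(\<Sum>t\<in>T. (n t)\<^sup>2) = (\<Sum>x\<in>U. n (g x))"
    by (simp add: sum_fibers power2_eq_square)
  finally have "real (card U) ^ 2 / card T \<le> (\<Sum>x\<in>U. n (g x))"
    using assms by (simp add: divide_le_eq card_gt_0_iff)
  then show ?thesis
    using n by (simp add: sum_subtractf)
qed

section \<open>Lines and directions in the plane over a field\<close>

text \<open>The pair \<open>(u, v)\<close> is a normal vector of the direction from \<open>x\<close>
  to \<open>y\<close>, and the constant is fixed by the incidence of \<open>x\<close>. For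
  \<open>x = y\<close> both coefficients vanish and over a field the whole plane results, so a
  genuine line requires \<open>x \<noteq> y\<close>.\<close>

definition line_through :: "('a, 'm) ring_scheme \<Rightarrow> 'a \<times> 'a \<Rightarrow> 'a \<times> 'a \<Rightarrow> ('a \<times> 'a) set" where
  "line_through F x y = (let u = snd y \<ominus>\<^bsub>F\<^esub> snd x; v = fst x \<ominus>\<^bsub>F\<^esub> fst y in
     line_of F u v (u \<otimes>\<^bsub>F\<^esub> fst x \<oplus>\<^bsub>F\<^esub> v \<otimes>\<^bsub>F\<^esub> snd x))"

text \<open>The direction of \<open>x\<close> seen from \<open>z\<close>, a point of the projective
  line: \<open>None\<close> is the vertical direction. The undefined case \<open>x = z\<close> also
  falls under \<open>None\<close>, which is harmless since \<open>z\<close> is collinear with itself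
  and any other point.\<close>

definition slope :: "('a, 'm) ring_scheme \<Rightarrow> 'a \<times> 'a \<Rightarrow> 'a \<times> 'a \<Rightarrow> 'a option" where
  "slope F z x = (if fst x = fst z then None
     else Some ((snd x \<ominus>\<^bsub>F\<^esub> snd z) \<otimes>\<^bsub>F\<^esub> inv\<^bsub>F\<^esub> (fst x \<ominus>\<^bsub>F\<^esub> fst z)))"

context field
begin

lemma minus_eq_zero_iff:
  assumes [simp]: "a \<in> carrier R" "b \<in> carrier R"
  shows "a \<ominus> b = \<zero> \<longleftrightarrow> a = b"
  by (metis assms a_inv_closed minus_eq minus_equality minus_minus r_neg)

lemma line_through_in_lines:
  assumes "x \<in> plane R" "y \<in> plane R" "x \<noteq> y"
  shows "line_through R x y \<in> lines R"
proof -
  have "\<not> (snd y \<ominus> snd x = \<zero> \<and> fst x \<ominus> fst y = \<zero>)"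
    using assms by (auto simp: plane_def prod_eq_iff minus_eq_zero_iff)
  then show ?thesis
    using assms unfolding line_through_def lines_def Let_def plane_def by fastforce
qed

lemma minus_minus_cancel:
  assumes [simp]: "a \<in> carrier R" "b \<in> carrier R" "c \<in> carrier R"
  shows "(a \<ominus> c) \<ominus> (b \<ominus> c) = a \<ominus> b"
  by (simp add: minus_eq minus_add a_assoc a_comm[of "\<ominus> b" c] r_neg1)

lemma add_eq_add_iff_minus_eq_minus:
  assumes [simp]: "a \<in> carrier R" "b \<in> carrier R" "c \<in> carrier R" "d \<in> carrier R"
  shows "a \<oplus> b = c \<oplus> d \<longleftrightarrow> a \<ominus> c = d \<ominus> b"
proof -
  have "a \<ominus> c \<oplus> (b \<oplus> c) = a \<oplus> b"
    by (simp add: minus_eq a_ac r_neg r_neg1 r_neg2)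
  moreover have "d \<ominus> b \<oplus> (b \<oplus> c) = c \<oplus> d"
    by (simp add: minus_eq a_assoc r_neg1 a_comm[of d c])
  ultimately show ?thesis
    by (metis assms a_closed add.right_cancel minus_closed)
qed

lemma r_minus_distr:
  assumes [simp]: "x \<in> carrier R" "y \<in> carrier R" "z \<in> carrier R"
  shows "z \<otimes> (x \<ominus> y) = z \<otimes> x \<ominus> z \<otimes> y"
  by (simp add: minus_eq r_distr r_minus)

text \<open>Collinearity as the vanishing of a determinant: free of division, so that vertical lines
  need no separate treatment.\<close>

lemma mem_line_through_iff:
  assumes "x \<in> plane R" "y \<in> plane R" "z \<in> plane R"
  shows "z \<in> line_through R x y \<longleftrightarrow>
    (snd y \<ominus> snd x) \<otimes> (fst z \<ominus> fst x) = (fst y \<ominus> fst x) \<otimes> (snd z \<ominus> snd x)"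
proof -
  have c: "fst x \<in> carrier R" "snd x \<in> carrier R" "fst y \<in> carrier R" "snd y \<in> carrier R"
    "fst z \<in> carrier R" "snd z \<in> carrier R"
    using assms by (auto simp: plane_def)
  \<comment> \<open>Two sign changes cancel; this matches the orientation
    \<open>fst x \<ominus> fst y\<close> of the coefficient in \<open>line_through\<close>.\<close>
  have "(fst y \<ominus> fst x) \<otimes> (snd z \<ominus> snd x) = (fst x \<ominus> fst y) \<otimes> (snd x \<ominus> snd z)"
  proof -
    have "fst y \<ominus> fst x = \<ominus> (fst x \<ominus> fst y)" "snd z \<ominus> snd x = \<ominus> (snd x \<ominus> snd z)"
      using c by (simp_all add: minus_eq minus_add a_comm)
    then show ?thesis
      using c by (simp add: l_minus r_minus)
  qed
  then show ?thesis
    using assms(3) c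
    by (simp add: line_through_def line_of_def Let_def case_prod_beta
        add_eq_add_iff_minus_eq_minus r_minus_distr)
qed

lemma line_through_endpoints:
  assumes "x \<in> plane R" "y \<in> plane R"
  shows "x \<in> line_through R x y" "y \<in> line_through R x y"
proof -
  have c: "fst x \<in> carrier R" "snd x \<in> carrier R" "fst y \<in> carrier R" "snd y \<in> carrier R"
    using assms by (auto simp: plane_def)
  show "x \<in> line_through R x y" "y \<in> line_through R x y"
    using assms c by (auto simp: mem_line_through_iff minus_eq r_neg intro: m_comm)
qed

lemma slope_mult:
  assumes "x \<in> plane R" "z \<in> plane R" "slope R z x = Some s"
  shows "s \<in> carrier R" "snd x \<ominus> snd z = s \<otimes> (fst x \<ominus> fst z)"
proof -
  have c: "fst x \<in> carrier R" "fst z \<in> carrier R" "snd x \<in> carrier R" "snd z \<in> carrier R"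
    using assms by (auto simp: plane_def)
  have ne: "fst x \<ominus> fst z \<noteq> \<zero>" and s: "s = (snd x \<ominus> snd z) \<otimes> inv (fst x \<ominus> fst z)"
    using assms c by (auto simp: slope_def minus_eq_zero_iff split: if_splits)
  then have U: "fst x \<ominus> fst z \<in> Units R"
    using c field_Units by auto
  then show "s \<in> carrier R" using c s by simp
  show "snd x \<ominus> snd z = s \<otimes> (fst x \<ominus> fst z)"
    using U c s by (simp add: m_assoc)
qed

text \<open>In the vertical case all first coordinates agree and both sides of the determinant
  criterion vanish. Otherwise a common slope \<open>s\<close> seen from \<open>z\<close> is also the
  slope of \<open>y - x\<close> and of \<open>z - x\<close>, and both sides equal \<open>s\<close>
  times the product of the two horizontal differences.\<close>

lemma slope_eq_imp_collinear:
  assumes "x \<in> plane R" "y \<in> plane R" "z \<in> plane R" "slope R z x = slope R z y"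
  shows "z \<in> line_through R x y"
proof -
  have c [simp]: "fst x \<in> carrier R" "snd x \<in> carrier R" "fst y \<in> carrier R" "snd y \<in> carrier R"
    "fst z \<in> carrier R" "snd z \<in> carrier R"
    using assms by (auto simp: plane_def)
  show ?thesis
  proof (cases "slope R z x")
    case None
    then have "fst x = fst z" "fst y = fst z"
      using assms(4) by (auto simp: slope_def split: if_splits)
    then show ?thesis
      using assms by (simp add: mem_line_through_iff minus_eq r_neg)
  next
    case (Some s)
    have s: "s \<in> carrier R" "snd x \<ominus> snd z = s \<otimes> (fst x \<ominus> fst z)"
      "snd y \<ominus> snd z = s \<otimes> (fst y \<ominus> fst z)"
      using slope_mult[OF assms(1,3) Some] slope_mult[OF assms(2,3)] Some assms(4) by auto
    have yx: "snd y \<ominus> snd x = s \<otimes> (fst y \<ominus> fst x)"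
      using s minus_minus_cancel[of "snd y" "snd x" "snd z"]
        minus_minus_cancel[of "fst y" "fst x" "fst z"]
        r_minus_distr[of "fst y \<ominus> fst z" "fst x \<ominus> fst z" s] by simp
    have "\<ominus> (snd x \<ominus> snd z) = s \<otimes> \<ominus> (fst x \<ominus> fst z)"
      using s(1) by (simp add: s(2) r_minus)
    then have zx: "snd z \<ominus> snd x = s \<otimes> (fst z \<ominus> fst x)"
      by (simp add: minus_eq minus_add a_comm)
    show ?thesis
      using assms s(1) by (simp add: mem_line_through_iff yx zx m_ac)
  qed
qed

lemma finite_plane: "finite (carrier R) \<Longrightarrow> finite (plane R)"
  and card_plane: "card (plane R) = (card (carrier R))\<^sup>2"
  by (auto simp: plane_def card_cartesian_product power2_eq_square)

section \<open>Collinear triples, large degrees and containers for arcs\<close>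

text \<open>The fibre count applied to \<open>slope R z\<close>: there are
  \<open>card (carrier R) + 1\<close> directions, and two points in the same direction from
  \<open>z\<close> are collinear with \<open>z\<close>.\<close>

lemma card_collinear_pairs_ge:
  assumes fin: "finite (carrier R)" and "U \<subseteq> plane R" "z \<in> plane R"
  shows "real (card U) ^ 2 / (card (carrier R) + 1) - card U
           \<le> (\<Sum>x\<in>U. real (card {y \<in> U. y \<noteq> x \<and> z \<in> line_through R x y}))"
proof -
  define T where "T = insert None (Some ` carrier R)"
  have T: "finite T" "T \<noteq> {}" "card T = card (carrier R) + 1"
    using fin by (auto simp: T_def card_image card_insert_if)
  have finU: "finite U" using assms finite_plane finite_subset by blast
  have "slope R z ` U \<subseteq> T"
  proof
    fix t assume "t \<in> slope R z ` U"
    then obtain x where "x \<in> plane R" "t = slope R z x" using assms by auto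
    then show "t \<in> T" using slope_mult(1)[of x z] \<open>z \<in> plane R\<close>
      by (cases t) (auto simp: T_def)
  qed
  then have "real (card U) ^ 2 / card T - card U
      \<le> (\<Sum>x\<in>U. real (card {y \<in> U. y \<noteq> x \<and> slope R z y = slope R z x}))"
    by (intro card_fiber_pairs_ge) (use T finU in auto)
  also have "\<dots> \<le> (\<Sum>x\<in>U. real (card {y \<in> U. y \<noteq> x \<and> z \<in> line_through R x y}))"
  proof (intro sum_mono of_nat_mono card_mono)
    fix x assume "x \<in> U"
    then have "z \<in> line_through R x y" if "y \<in> U" "slope R z y = slope R z x" for y
      using that assms by (intro slope_eq_imp_collinear) auto
    then show "{y \<in> U. y \<noteq> x \<and> slope R z y = slope R z x} \<subseteq> {y \<in> U. y \<noteq> x \<and> z \<in> line_through R x y}"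
      by (intro Collect_mono) simp
  qed (use finU in auto)
  finally show ?thesis using T by simp
qed

lemma card_arc_Int_line_le:
  assumes "arc_in R B" "finite B" "l \<in> lines R"
  shows "card (B \<inter> l) \<le> 2"
proof (rule ccontr)
  assume "\<not> card (B \<inter> l) \<le> 2"
  then have "3 \<le> card (B \<inter> l)" by simp
  then obtain T where "T \<subseteq> B \<inter> l" "card T = 3"
    by (metis obtain_subset_with_card_n)
  then obtain x y z where "{x, y, z} \<subseteq> B \<inter> l" "x \<noteq> y" "y \<noteq> z" "x \<noteq> z"
    by (auto simp: card_3_iff)
  then show False using assms unfolding arc_in_def by blast
qed

text \<open>Double counting of triples \<open>(x, y, z)\<close> with \<open>z\<close> in
  \<open>B\<close> on the line through distinct \<open>x\<close>, \<open>y\<close> in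
  \<open>U\<close>. Each point \<open>z\<close> contributes many pairs, while each pair is counted
  at most twice because \<open>B\<close> is an arc. The constant 4 is made up of this factor 2 and
  of another one lost in absorbing the diagonal term \<open>u\<close>.\<close>

lemma exists_large_degree:
  assumes fin: "finite (carrier R)" and B: "arc_in R B" and U: "U \<subseteq> plane R"
    and big: "real (card U) > 2 * (card (carrier R) + 1)"
  shows "\<exists>v\<in>U. real (card {y \<in> U. y \<noteq> v \<and> (\<exists>z\<in>B. z \<in> line_through R v y)})
           \<ge> card B / (4 * (card (carrier R) + 1)) * card U"
proof (rule ccontr)
  define D where "D = real (card (carrier R) + 1)"
  define u where "u = real (card U)"
  define b where "b = real (card B)"
  define deg where "deg = (\<lambda>x. real (card {y \<in> U. y \<noteq> x \<and> (\<exists>z\<in>B. z \<in> line_through R x y)}))"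
  have D: "D > 0" and u: "u > 2 * D" using big by (simp_all add: D_def u_def)
  have B': "B \<subseteq> plane R" using B by (simp add: arc_in_def)
  have fins: "finite U" "finite B" using finite_plane[OF fin] U B' finite_subset by blast+
  assume "\<not> ?thesis"
  then have lt: "deg x < b / (4 * D) * u" if "x \<in> U" for x
    using that by (auto simp: deg_def D_def u_def b_def not_le)
  have "U \<noteq> {}" using u D by (auto simp: u_def)
  have "b * (u\<^sup>2 / D - u) = (\<Sum>z\<in>B. u\<^sup>2 / D - u)"
    by (simp add: b_def)
  also have "\<dots> \<le> (\<Sum>z\<in>B. \<Sum>x\<in>U. real (card {y \<in> U. y \<noteq> x \<and> z \<in> line_through R x y}))"
    using card_collinear_pairs_ge[OF fin U] B' by (intro sum_mono) (auto simp: D_def u_def)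
  also have "\<dots> = (\<Sum>x\<in>U. \<Sum>z\<in>B. real (card {y \<in> U. y \<noteq> x \<and> z \<in> line_through R x y}))"
    by (rule sum.swap)
  also have "\<dots> \<le> (\<Sum>x\<in>U. 2 * deg x)"
  proof (rule sum_mono)
    fix x assume x: "x \<in> U"
    define W where "W = {y \<in> U. y \<noteq> x \<and> (\<exists>z\<in>B. z \<in> line_through R x y)}"
    have W: "finite W" "W \<subseteq> U" using fins by (auto simp: W_def)
    have "(\<Sum>z\<in>B. real (card {y \<in> U. y \<noteq> x \<and> z \<in> line_through R x y}))
        = (\<Sum>z\<in>B. \<Sum>y\<in>W. of_bool (z \<in> line_through R x y))"
    proof (rule sum.cong)
      fix z assume "z \<in> B"
      then have "{y \<in> U. y \<noteq> x \<and> z \<in> line_through R x y} = W \<inter> {y. z \<in> line_through R x y}"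
        by (auto simp: W_def)
      then show "real (card {y \<in> U. y \<noteq> x \<and> z \<in> line_through R x y})
          = (\<Sum>y\<in>W. of_bool (z \<in> line_through R x y))"
        using W by (simp add: sum_of_bool_eq)
    qed simp
    also have "\<dots> = (\<Sum>y\<in>W. \<Sum>z\<in>B. of_bool (z \<in> line_through R x y))"
      by (rule sum.swap)
    also have "\<dots> \<le> (\<Sum>y\<in>W. 2)"
    proof (rule sum_mono)
      fix y assume y: "y \<in> W"
      have "card (B \<inter> line_through R x y) \<le> 2"
        by (rule card_arc_Int_line_le[OF B fins(2)])
          (rule line_through_in_lines, use x y U in \<open>auto simp: W_def\<close>)
      then show "(\<Sum>z\<in>B. of_bool (z \<in> line_through R x y)) \<le> (2 :: real)"
        using fins by (simp add: sum_of_bool_eq)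
    qed
    also have "\<dots> = 2 * deg x" by (simp add: deg_def W_def)
    finally show "(\<Sum>z\<in>B. real (card {y \<in> U. y \<noteq> x \<and> z \<in> line_through R x y})) \<le> 2 * deg x" .
  qed
  also have "\<dots> < (\<Sum>x\<in>U. 2 * (b / (4 * D) * u))"
  proof (rule sum_strict_mono)
    show "2 * deg x < 2 * (b / (4 * D) * u)" if "x \<in> U" for x
      using lt[OF that] by linarith
  qed (use fins \<open>U \<noteq> {}\<close> in auto)
  also have "\<dots> = b * (u\<^sup>2 / (2 * D))"
    by (simp add: u_def power2_eq_square)
  finally have "b * (u\<^sup>2 / D - u) < b * (u\<^sup>2 / (2 * D))" .
  \<comment> \<open>This is where \<open>u > 2 * D\<close> enters: the diagonal term
    \<open>u\<close> is at most half of \<open>u\<^sup>2 / D\<close>.\<close>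
  moreover have "u\<^sup>2 / D - u \<ge> u\<^sup>2 / (2 * D)"
    using D u by (simp add: field_simps power2_eq_square)
  ultimately show False
    using mult_left_mono[of "u\<^sup>2 / (2 * D)" "u\<^sup>2 / D - u" b] by (simp add: b_def)
qed

text \<open>A point of \<open>B\<close> on the line through two points of \<open>A - B\<close> would
  be a third point of the arc on that line. So \<open>A - B\<close> is independent for
  \<open>E\<close>, and the container family of that graph applies. The bound on
  \<open>card B\<close> keeps the degree fraction at most 1.\<close>

lemma arc_containers:
  assumes fin: "finite (carrier R)" and B: "arc_in R B" "card B \<le> 4 * (card (carrier R) + 1)"
    and j: "(1 - card B / (4 * (card (carrier R) + 1))) ^ j * (card (carrier R))\<^sup>2
              \<le> 2 * (card (carrier R) + 1)"
  shows "\<exists>\<C>. finite \<C> \<and> card \<C> \<le> ((card (carrier R))\<^sup>2 + 1) ^ j \<and>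
           (\<forall>C\<in>\<C>. C \<subseteq> plane R \<and> card C \<le> 2 * (card (carrier R) + 1) + j) \<and>
           (\<forall>A. arc_in R A \<and> B \<subseteq> A \<longrightarrow> (\<exists>C\<in>\<C>. A - B \<subseteq> C))"
proof -
  define E where "E = (\<lambda>x y. \<exists>z\<in>B. z \<in> line_through R x y)"
  define q where "q = card (carrier R)"
  have "\<exists>\<C>. finite \<C> \<and> card \<C> \<le> (card (plane R) + 1) ^ j \<and>
          (\<forall>C\<in>\<C>. C \<subseteq> plane R \<and> real (card C) \<le> real (2 * (q + 1)) + j) \<and>
          (\<forall>I\<subseteq>plane R. (\<forall>x\<in>I. \<forall>y\<in>I. x \<noteq> y \<longrightarrow> \<not> E x y) \<longrightarrow> (\<exists>C\<in>\<C>. I \<subseteq> C))"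
  proof (rule container_family[where d = "card B / (4 * (q + 1))"])
    show "real (card B) / real (4 * (q + 1)) \<le> 1"
      using B(2) by (simp add: q_def field_simps del: of_nat_Suc)
    show "\<exists>v\<in>U. real (card {y \<in> U. y \<noteq> v \<and> E v y}) \<ge> real (card B) / real (4 * (q + 1)) * card U"
      if "U \<subseteq> plane R" "real (card U) > real (2 * (q + 1))" for U
      using exists_large_degree[OF fin B(1) that(1)] that(2) by (simp add: E_def q_def)
    show "(1 - real (card B) / real (4 * (q + 1))) ^ j * real (card (plane R)) \<le> real (2 * (q + 1))"
      using j by (simp add: card_plane q_def)
  qed (use finite_plane[OF fin] in auto)
  then obtain \<C> where C: "finite \<C>" "card \<C> \<le> (card (plane R) + 1) ^ j"
    "\<forall>C\<in>\<C>. C \<subseteq> plane R \<and> real (card C) \<le> real (2 * (q + 1)) + j"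
    "\<forall>I\<subseteq>plane R. (\<forall>x\<in>I. \<forall>y\<in>I. x \<noteq> y \<longrightarrow> \<not> E x y) \<longrightarrow> (\<exists>C\<in>\<C>. I \<subseteq> C)"
    by (elim exE conjE) (rule that)
  have cardC: "C \<subseteq> plane R \<and> card C \<le> 2 * (q + 1) + j" if "C \<in> \<C>" for C
    using bspec[OF C(3) that] by linarith
  have "\<exists>C\<in>\<C>. A - B \<subseteq> C" if A: "arc_in R A" "B \<subseteq> A" for A
  proof (rule C(4)[THEN spec, THEN mp, THEN mp])
    have sub: "A \<subseteq> plane R" using A by (simp add: arc_in_def)
    then show "A - B \<subseteq> plane R" by auto
    show "\<forall>x\<in>A - B. \<forall>y\<in>A - B. x \<noteq> y \<longrightarrow> \<not> E x y"
    proof (intro ballI impI notI)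
      fix x y assume xy: "x \<in> A - B" "y \<in> A - B" "x \<noteq> y" "E x y"
      then obtain z where z: "z \<in> B" "z \<in> line_through R x y" by (auto simp: E_def)
      have p: "x \<in> plane R" "y \<in> plane R" using xy sub by auto
      have "x \<noteq> z" "y \<noteq> z" "z \<in> A" using xy z A by auto
      then show False
        using A(1) xy z(2) line_through_endpoints[OF p] line_through_in_lines[OF p xy(3)]
        unfolding arc_in_def by blast
    qed
  qed
  then show ?thesis
    using C(1,2) cardC unfolding q_def card_plane by (intro exI[of _ \<C>]) simp
qed

end

section \<open>Tail bound for a random subset\<close>

text \<open>Chernoff's method with base 2: by independence the expectation of
  \<open>2 ^ card (Q \<inter> C)\<close> is \<open>(1 + p) ^ card C\<close>, at most
  \<open>exp (p * card C)\<close>, and Markov's inequality finishes.\<close>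

lemma prob_card_random_subset_Int_ge_le:
  assumes "finite A" "C \<subseteq> A" "0 \<le> p" "p \<le> 1"
  shows "measure_pmf.prob (random_subset A p) {Q. real (card (Q \<inter> C)) \<ge> t}
           \<le> exp (p * card C) * 2 powr (- t)"
proof -
  define M where "M = Pi_pmf A False (\<lambda>_. bernoulli_pmf p)"
  \<comment> \<open>One factor per point, equal to 2 exactly at the selected points of
    \<open>C\<close>, so that the product is the exponential moment and its expectation
    factorises.\<close>
  define g :: "'a \<Rightarrow> bool \<Rightarrow> real" where "g = (\<lambda>x v. if x \<in> C \<and> v then 2 else 1)"
  have g_prod: "(\<Prod>x\<in>A. g x (b x)) = 2 ^ card ({x \<in> A. b x} \<inter> C)" for b
  proof -
    have "(\<Prod>x\<in>A. g x (b x)) = (\<Prod>x\<in>{x \<in> A. b x} \<inter> C. 2)"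
      by (rule prod.mono_neutral_cong_right) (use assms in \<open>auto simp: g_def\<close>)
    then show ?thesis by simp
  qed
  have "finite (set_pmf M)"
    unfolding M_def using assms(1) by (auto simp: set_Pi_pmf)
  then have int: "integrable M (\<lambda>b. \<Prod>x\<in>A. g x (b x))"
    by (rule integrable_measure_pmf_finite)
  have "measure_pmf.expectation M (\<lambda>b. \<Prod>x\<in>A. g x (b x))
      = (\<Prod>x\<in>A. measure_pmf.expectation (bernoulli_pmf p) (g x))"
    unfolding M_def
    by (rule expectation_prod_Pi_pmf)
      (use assms in \<open>auto simp: g_def intro: integrable_measure_pmf_finite\<close>)
  also have "\<dots> = (\<Prod>x\<in>A. if x \<in> C then 1 + p else 1)"
    using assms by (intro prod.cong) (auto simp: g_def algebra_simps)
  also have "\<dots> = (\<Prod>x\<in>C. 1 + p)"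
    by (rule prod.mono_neutral_cong_right) (use assms in auto)
  also have "\<dots> \<le> exp p ^ card C"
    using assms by (auto intro!: power_mono)
  also have "\<dots> = exp (p * card C)"
    by (simp add: exp_of_nat2_mult)
  finally have E: "measure_pmf.expectation M (\<lambda>b. \<Prod>x\<in>A. g x (b x)) \<le> exp (p * card C)" .
  have "measure_pmf.prob (random_subset A p) {Q. real (card (Q \<inter> C)) \<ge> t}
      = measure_pmf.prob M {b \<in> space M. (\<Prod>x\<in>A. g x (b x)) \<ge> 2 powr t}"
    unfolding random_subset_def M_def[symmetric] g_prod
    by (simp add: vimage_def powr_realpow[symmetric])
  also have "\<dots> \<le> measure_pmf.expectation M (\<lambda>b. \<Prod>x\<in>A. g x (b x)) / 2 powr t"
    by (rule integral_Markov_inequality_measure[where A = "{}"])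
      (use int in \<open>auto simp: g_prod\<close>)
  also have "\<dots> \<le> exp (p * card C) / 2 powr t"
    using E by (intro divide_right_mono) auto
  finally show ?thesis by (simp add: powr_minus divide_inverse)
qed

section \<open>Union bound over arcs and containers\<close>

lemma arc_in_subset:
  assumes "arc_in F A" "B \<subseteq> A"
  shows "arc_in F B"
  unfolding arc_in_def
proof (intro conjI ballI)
  show "B \<subseteq> plane F" using assms by (auto simp: arc_in_def)
  fix x y z assume "x \<in> B" "y \<in> B" "z \<in> B"
  then have "x \<in> A" "y \<in> A" "z \<in> A" using assms(2) by auto
  then show "x \<noteq> y \<and> y \<noteq> z \<and> x \<noteq> z \<longrightarrow> \<not> (\<exists>l\<in>lines F. x \<in> l \<and> y \<in> l \<and> z \<in> l)"
    using assms(1)[unfolded arc_in_def, THEN conjunct2, THEN bspec, THEN bspec, THEN bspec, of x y z]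
    by blast
qed

lemma max_arc_attained:
  assumes "finite P"
  obtains A where "A \<subseteq> P" "arc_in F A" "card A = max_arc F P"
proof -
  let ?S = "{card A | A. A \<subseteq> P \<and> arc_in F A}"
  have "?S \<subseteq> card ` Pow P" by auto
  then have fin: "finite ?S" using assms by (simp add: finite_subset)
  have "?S \<noteq> {}"
    by (auto intro!: exI[of _ "{}"] simp: arc_in_def)
  from Max_in[OF fin this] obtain A where "Max ?S = card A" "A \<subseteq> P" "arc_in F A"
    unfolding mem_Collect_eq by (elim exE conjE)
  then show thesis using that[of A] by (simp add: max_arc_def)
qed

lemma binomial_le_power: "n choose k \<le> n ^ k"
  by (cases "k \<le> n") (auto simp: binomial_le_pow not_le binomial_eq_0)

text \<open>A large arc in \<open>Q\<close> contains some arc \<open>B\<close> of size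
  \<open>b\<close>, and its other points, at least \<open>t - b\<close> of them, lie in one
  container of \<open>B\<close>. The union bound runs over at most \<open>(q\<^sup>2) ^ b\<close>
  sets \<open>B\<close> and \<open>(q\<^sup>2 + 1) ^ j\<close> containers for each.\<close>

lemma prob_max_arc_ge_le:
  fixes F :: "('a, 'm) ring_scheme" and p t :: real and b j :: nat
  assumes F: "field F" "finite (carrier F)" "card (carrier F) = q"
    and p: "0 \<le> p" "p \<le> 1"
    and b: "b \<le> 4 * (q + 1)" "real b \<le> t"
    and j: "(1 - b / (4 * (q + 1))) ^ j * q\<^sup>2 \<le> 2 * (q + 1)"
  shows "measure_pmf.prob (random_subset (plane F) p) {Q. real (max_arc F Q) \<ge> t}
      \<le> real ((q\<^sup>2) ^ b * (q\<^sup>2 + 1) ^ j) * (exp (p * real (2 * (q + 1) + j)) * 2 powr (b - t))"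
proof -
  interpret field F by fact
  define M where "M = random_subset (plane F) p"
  define X where "X = exp (p * real (2 * (q + 1) + j)) * 2 powr (b - t)"
  note fin = finite_plane[OF F(2)]
  have cp: "card (plane F) = q\<^sup>2" by (simp add: card_plane F(3))
  \<comment> \<open>All arcs of size \<open>b\<close> in the plane, independently of the random set,
    so that the union bound is over a fixed family.\<close>
  define \<B> where "\<B> = {B. B \<subseteq> plane F \<and> card B = b \<and> arc_in F B}"
  have B: "finite \<B>" "card \<B> \<le> (q\<^sup>2) ^ b"
  proof -
    have sub: "\<B> \<subseteq> {B. B \<subseteq> plane F \<and> card B = b}" by (auto simp: \<B>_def)
    have fin': "finite {B. B \<subseteq> plane F \<and> card B = b}" using fin by simp
    show "finite \<B>" using sub fin' finite_subset by blast
    have "card \<B> \<le> card (plane F) choose b"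
      using card_mono[OF fin' sub] n_subsets[OF fin] by simp
    then show "card \<B> \<le> (q\<^sup>2) ^ b"
      using binomial_le_power[of "q\<^sup>2" b] by (simp add: cp)
  qed
  have "\<forall>B\<in>\<B>. \<exists>\<C>. finite \<C> \<and> card \<C> \<le> (q\<^sup>2 + 1) ^ j \<and>
           (\<forall>C\<in>\<C>. C \<subseteq> plane F \<and> card C \<le> 2 * (q + 1) + j) \<and>
           (\<forall>A. arc_in F A \<and> B \<subseteq> A \<longrightarrow> (\<exists>C\<in>\<C>. A - B \<subseteq> C))"
  proof
    fix B assume "B \<in> \<B>"
    then have "arc_in F B" "card B = b" by (auto simp: \<B>_def)
    then show "\<exists>\<C>. finite \<C> \<and> card \<C> \<le> (q\<^sup>2 + 1) ^ j \<and>
           (\<forall>C\<in>\<C>. C \<subseteq> plane F \<and> card C \<le> 2 * (q + 1) + j) \<and>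
           (\<forall>A. arc_in F A \<and> B \<subseteq> A \<longrightarrow> (\<exists>C\<in>\<C>. A - B \<subseteq> C))"
      using arc_containers[OF F(2), of B j] b(1) j unfolding F(3) by (simp add: add_ac)
  qed
  then obtain \<C> where C_all: "\<forall>B\<in>\<B>. finite (\<C> B) \<and> card (\<C> B) \<le> (q\<^sup>2 + 1) ^ j \<and>
           (\<forall>C\<in>\<C> B. C \<subseteq> plane F \<and> card C \<le> 2 * (q + 1) + j) \<and>
           (\<forall>A. arc_in F A \<and> B \<subseteq> A \<longrightarrow> (\<exists>C\<in>\<C> B. A - B \<subseteq> C))"
    by (elim bchoice[THEN exE])
  have C: "finite (\<C> B)" "card (\<C> B) \<le> (q\<^sup>2 + 1) ^ j"
    "\<And>C. C \<in> \<C> B \<Longrightarrow> C \<subseteq> plane F \<and> card C \<le> 2 * (q + 1) + j"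
    "\<And>A. arc_in F A \<Longrightarrow> B \<subseteq> A \<Longrightarrow> \<exists>C\<in>\<C> B. A - B \<subseteq> C" if "B \<in> \<B>" for B
    using bspec[OF C_all that] by simp_all
  define ev :: "('a \<times> 'a) set \<Rightarrow> ('a \<times> 'a) set set"
    where "ev = (\<lambda>C. {Q. real (card (Q \<inter> C)) \<ge> t - b})"
  have ev: "measure_pmf.prob M (ev C) \<le> X" if "B \<in> \<B>" "C \<in> \<C> B" for B C
  proof -
    have "measure_pmf.prob M (ev C) \<le> exp (p * card C) * 2 powr (- (t - b))"
      unfolding M_def ev_def
      by (rule prob_card_random_subset_Int_ge_le) (use C(3)[OF that] fin p in auto)
    also have "\<dots> \<le> X"
      unfolding X_def using C(3)[OF that] p
      by (intro mult_mono) (auto intro!: mult_left_mono)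
    finally show ?thesis .
  qed
  \<comment> \<open>On the support, \<open>Q\<close> is a subset of the finite plane, so
    \<open>max_arc\<close> is attained by an actual arc.\<close>
  have "measure_pmf.prob M {Q. real (max_arc F Q) \<ge> t} =
      measure_pmf.prob M ({Q. real (max_arc F Q) \<ge> t} \<inter> set_pmf M)"
    by (simp add: measure_Int_set_pmf)
  also have "\<dots> \<le> measure_pmf.prob M (\<Union>B\<in>\<B>. \<Union>C\<in>\<C> B. ev C)"
  proof (intro measure_pmf.finite_measure_mono subsetI)
    fix Q assume Q: "Q \<in> {Q. real (max_arc F Q) \<ge> t} \<inter> set_pmf M"
    then have subQ: "Q \<subseteq> plane F" by (auto simp: M_def random_subset_def)
    then have finQ: "finite Q" using fin finite_subset by blast
    obtain A where A: "A \<subseteq> Q" "arc_in F A" "card A = max_arc F Q"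
      using max_arc_attained[OF finQ] .
    have finA: "finite A" using A finQ finite_subset by blast
    have tA: "t \<le> real (card A)" using Q A by simp
    then have "b \<le> card A" using b(2) by linarith
    then obtain B where B: "B \<subseteq> A" "card B = b"
      by (metis obtain_subset_with_card_n)
    have "arc_in F B" using arc_in_subset[OF A(2) B(1)] .
    moreover have "B \<subseteq> plane F" using B(1) A(1) subQ by (metis order_trans)
    ultimately have BB: "B \<in> \<B>" using B(2) by (simp add: \<B>_def)
    then obtain C where CC: "C \<in> \<C> B" "A - B \<subseteq> C" using C(4) A(2) B(1) by blast
    have "card A - b = card (A - B)"
      using B finA finite_subset by (subst card_Diff_subset) auto
    also have "\<dots> \<le> card (Q \<inter> C)"
      using CC(2) A(1) finQ by (intro card_mono) auto
    finally have "Q \<in> ev C" using tA by (simp add: ev_def)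
    then show "Q \<in> (\<Union>B\<in>\<B>. \<Union>C\<in>\<C> B. ev C)" using BB CC by blast
  qed simp
  also have "\<dots> \<le> (\<Sum>B\<in>\<B>. measure_pmf.prob M (\<Union>C\<in>\<C> B. ev C))"
    by (rule measure_UNION_le) (use B in auto)
  also have "\<dots> \<le> (\<Sum>B\<in>\<B>. \<Sum>C\<in>\<C> B. measure_pmf.prob M (ev C))"
    by (intro sum_mono measure_UNION_le) (use C in auto)
  also have "\<dots> \<le> (\<Sum>B\<in>\<B>. (q\<^sup>2 + 1) ^ j * X)"
  proof (rule sum_mono)
    fix B assume B: "B \<in> \<B>"
    have "(\<Sum>C\<in>\<C> B. measure_pmf.prob M (ev C)) \<le> real (card (\<C> B)) * X"
      using ev[OF B] by (rule sum_bounded_above)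
    also have "\<dots> \<le> real ((q\<^sup>2 + 1) ^ j) * X"
      using C(2)[OF B] by (intro mult_right_mono of_nat_mono) (auto simp: X_def)
    finally show "(\<Sum>C\<in>\<C> B. measure_pmf.prob M (ev C)) \<le> (q\<^sup>2 + 1) ^ j * X" by simp
  qed
  also have "\<dots> = real (card \<B>) * ((q\<^sup>2 + 1) ^ j * X)" by simp
  also have "\<dots> \<le> real ((q\<^sup>2) ^ b) * ((q\<^sup>2 + 1) ^ j * X)"
    using B(2) by (intro mult_right_mono of_nat_mono) (auto simp: X_def)
  finally show ?thesis
    by (simp add: M_def X_def mult.assoc)
qed

section \<open>Choice of parameters and the limit\<close>

text \<open>The previous bound with \<open>b\<close> about \<open>sqrt q\<close> and
  \<open>j\<close> about \<open>8 * sqrt q * ln q\<close>. The container size costs a factor of at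
  most \<open>exp (5 * q * p)\<close>, while \<open>c \<ge> 12\<close> gains at least
  \<open>exp (6 * q * p)\<close>; the surplus \<open>q * p\<close> is at least
  \<open>q powr (2 / 3)\<close>.\<close>

lemma prob_max_arc_ge_le_exp:
  fixes F :: "('a, 'm) ring_scheme" and p c :: real
  assumes F: "field F" "finite (carrier F)" "card (carrier F) = q"
    and p: "real q powr (- 1 / 3) \<le> p" "p \<le> 1" and c: "12 \<le> c"
    and q1: "8 * (real q + 1) * ln (real q) / sqrt (real q) + 1 \<le> real q"
    and q2: "sqrt (real q) + 1 \<le> real q powr (2 / 3)" and "2 \<le> q"
  shows "measure_pmf.prob (random_subset (plane F) p) {Q. real (max_arc F Q) \<ge> real q * p * c}
      \<le> exp (2 * (sqrt (real q) + 1) * ln (real q)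
           + (8 * (real q + 1) * ln (real q) / sqrt (real q) + 1) * ln ((real q)\<^sup>2 + 1)
           + (sqrt (real q) + 1) - real q powr (2 / 3))"
proof -
  define x where "x = real q"
  have x: "x \<ge> 2" using \<open>2 \<le> q\<close> by (simp add: x_def)
  \<comment> \<open>Chosen so that \<open>sqrt x / (4 * (x + 1)) * J = 2 * ln x\<close>: then
    \<open>exp (- d * j)\<close> compensates the \<open>x\<^sup>2\<close> points of the
    plane.\<close>
  define J where "J = 8 * (x + 1) * ln x / sqrt x"
  define b where "b = nat \<lceil>sqrt x\<rceil>"
  define j where "j = nat \<lceil>J\<rceil>"
  have J0: "J \<ge> 0" using x by (simp add: J_def)
  have bb: "sqrt x \<le> b" "b \<le> sqrt x + 1" "b > 0"
  proof -
    have "sqrt x > 0" using x by simp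
    then show "sqrt x \<le> b" "b \<le> sqrt x + 1" "b > 0" unfolding b_def by linarith+
  qed
  have jb: "J \<le> j" "j \<le> J + 1"
    using J0 unfolding j_def by linarith+
  have p0: "p > 0" using p(1) x by (smt (verit) powr_gt_zero x_def)
  have xp: "x powr (2 / 3) \<le> x * p"
  proof -
    have "x powr (2 / 3) = x powr 1 * x powr (- 1 / 3)"
      by (subst powr_add[symmetric]) simp
    also have "\<dots> \<le> x * p" using p(1) x by (auto simp: x_def)
    finally show ?thesis .
  qed
  \<comment> \<open>The threshold must be at least \<open>b\<close>, so that a large arc has a
    subset of size \<open>b\<close>.\<close>
  have "b \<le> x * p" using bb(2) q2 xp by (simp add: x_def)
  also have "\<dots> \<le> x * p * c" using c p0 x by simp
  finally have bt: "real b \<le> x * p * c" .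
  have "sqrt x \<le> x" using x by (simp add: real_sqrt_le_iff real_le_lsqrt self_le_power)
  then have b4: "b \<le> 4 * (q + 1)" using bb(2) by (simp add: x_def)
  define d where "d = b / (4 * (x + 1))"
  have d: "0 \<le> d" "d \<le> 1"
    using b4 x by (auto simp: d_def x_def divide_le_eq)
  have "2 * ln x = sqrt x / (4 * (x + 1)) * J"
  proof -
    have "s / (4 * y) * (8 * y * l / s) = 2 * l" if "s \<noteq> 0" "y \<noteq> 0" for s y l :: real
      using that by (simp add: field_simps)
    from this[of "sqrt x" "x + 1" "ln x"] show ?thesis using x by (simp add: J_def)
  qed
  also have "\<dots> \<le> d * j"
    unfolding d_def using bb jb J0 x by (intro mult_mono divide_right_mono) auto
  finally have dj: "2 * ln x \<le> d * j" .
  have "(1 - d) ^ j * x\<^sup>2 \<le> exp (- d) ^ j * x\<^sup>2"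
    using d exp_ge_add_one_self[of "- d"] by (intro mult_right_mono power_mono) auto
  also have "\<dots> = exp (- (d * j)) * exp (2 * ln x)"
    using x by (simp add: exp_of_nat2_mult[symmetric] exp_double)
  also have "\<dots> \<le> 1"
    using dj by (simp add: exp_add[symmetric])
  also have "1 \<le> 2 * (x + 1)" using x by simp
  finally have dj': "(1 - d) ^ j * x\<^sup>2 \<le> 2 * (x + 1)" .
  have "measure_pmf.prob (random_subset (plane F) p) {Q. real (max_arc F Q) \<ge> x * p * c}
      \<le> real ((q\<^sup>2) ^ b * (q\<^sup>2 + 1) ^ j) * (exp (p * real (2 * (q + 1) + j)) * 2 powr (b - x * p * c))"
    by (rule prob_max_arc_ge_le[OF F]) (use p0 p b4 bt dj' in \<open>auto simp: d_def x_def add_ac\<close>)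
  also have "\<dots> = (x\<^sup>2) ^ b * (x\<^sup>2 + 1) ^ j * (exp (p * (2 * (x + 1) + j)) * 2 powr (b - x * p * c))"
    by (simp add: x_def add_ac)
  also have "(x\<^sup>2) ^ b = exp (2 * b * ln x)"
  proof -
    have "exp (2 * b * ln x) = exp (b * (2 * ln x))" by (simp add: mult_ac)
    also have "\<dots> = exp (2 * ln x) ^ b" by (rule exp_of_nat_mult)
    also have "exp (2 * ln x) = x\<^sup>2" using x by (simp add: exp_double)
    finally show ?thesis by simp
  qed
  also have "(x\<^sup>2 + 1) ^ j = exp (j * ln (x\<^sup>2 + 1))"
    using x by (subst exp_of_nat_mult) (simp add: add_nonneg_pos)
  also have "2 powr (b - x * p * c) = exp ((b - x * p * c) * ln 2)"
    by (simp add: powr_def)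
  also have "exp (2 * b * ln x) * exp (j * ln (x\<^sup>2 + 1)) *
       (exp (p * (2 * (x + 1) + j)) * exp ((b - x * p * c) * ln 2))
     = exp (2 * b * ln x + j * ln (x\<^sup>2 + 1) + p * (2 * (x + 1) + j) + (b - x * p * c) * ln 2)"
    by (simp add: exp_add mult_ac)
  also have "\<dots> \<le> exp (2 * (sqrt x + 1) * ln x + (J + 1) * ln (x\<^sup>2 + 1) + (sqrt x + 1) - x powr (2 / 3))"
  proof -
    have 1: "2 * b * ln x \<le> 2 * (sqrt x + 1) * ln x"
      using bb x by (intro mult_right_mono) auto
    have 2: "j * ln (x\<^sup>2 + 1) \<le> (J + 1) * ln (x\<^sup>2 + 1)"
      using jb by (intro mult_right_mono) auto
    \<comment> \<open>By \<open>q1\<close> the budget \<open>j\<close> is at most \<open>x\<close>,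
      and \<open>2 * (x + 1) \<le> 3 * x\<close> since \<open>x \<ge> 2\<close>.\<close>
    have "p * (2 * (x + 1) + j) \<le> p * (5 * x)"
      using jb q1 x p0 by (intro mult_left_mono) (auto simp: J_def x_def)
    then have 3: "p * (2 * (x + 1) + j) \<le> 5 * (x * p)" by (simp add: mult_ac)
    have l2: "ln 2 \<ge> (1 / 2 :: real)" "ln 2 \<le> (1 :: real)"
      using ln2_ge_two_thirds ln_2_less_1 by linarith+
    have 4: "b * ln 2 \<le> sqrt x + 1"
      using mult_left_mono[OF l2(2), of b] bb by linarith
    have "6 * (x * p) = x * p * 12 * (1 / 2)" by simp
    also have "\<dots> \<le> x * p * c * ln 2"
      using x p0 c l2 by (intro mult_mono) auto
    finally have 5: "6 * (x * p) \<le> x * p * c * ln 2" .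
    show ?thesis
      using 1 2 3 4 5 xp by (simp add: left_diff_distrib)
  qed
  finally show ?thesis by (simp add: x_def J_def)
qed

theorem theorem6:
  fixes F :: "nat \<Rightarrow> 'a ring" and a :: real and f :: "real \<Rightarrow> real"
  assumes "\<And>q. primepow q \<Longrightarrow> field (F q) \<and> finite (carrier (F q)) \<and> card (carrier (F q)) = q"
    and "- 1 / 3 < a" and "a < 0"
    and "filterlim f at_top at_top"
  shows "((\<lambda>q. measure_pmf.prob (random_subset (plane (F q)) (real q powr a))
             {Q. real (max_arc (F q) Q) \<ge> real q * real q powr a * f (real q)})
           \<longlongrightarrow> 0) (inf at_top (principal {q. primepow q}))"
proof -
  \<comment> \<open>The positive terms of the exponent are of order at most
    \<open>sqrt x * (ln x)\<^sup>2\<close>, so \<open>- x powr (2 / 3)\<close> dominates.\<close>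
  define h :: "real \<Rightarrow> real" where
    "h = (\<lambda>x. exp (2 * (sqrt x + 1) * ln x + (8 * (x + 1) * ln x / sqrt x + 1) * ln (x\<^sup>2 + 1)
               + (sqrt x + 1) - x powr (2 / 3)))"
  have "(h \<longlongrightarrow> 0) at_top"
    unfolding h_def by real_asymp
  then have h: "((\<lambda>q. h (real q)) \<longlongrightarrow> 0) (inf at_top (principal {q. primepow q}))"
    by (intro tendsto_mono[OF inf_le1] filterlim_compose[OF _ filterlim_real_sequentially])
  have "eventually (\<lambda>x::real. f x \<ge> 12) at_top"
    using assms(4) by (simp add: filterlim_at_top)
  moreover have "eventually (\<lambda>x::real. 8 * (x + 1) * ln x / sqrt x + 1 \<le> x) at_top"
    by real_asymp
  moreover have "eventually (\<lambda>x::real. sqrt x + 1 \<le> x powr (2 / 3)) at_top"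
    by real_asymp
  ultimately have "eventually (\<lambda>x::real. f x \<ge> 12 \<and> 8 * (x + 1) * ln x / sqrt x + 1 \<le> x
      \<and> sqrt x + 1 \<le> x powr (2 / 3)) at_top"
    by eventually_elim simp
  then have ev: "eventually (\<lambda>q. f (real q) \<ge> 12 \<and> 8 * (real q + 1) * ln (real q) / sqrt (real q) + 1 \<le> real q
      \<and> sqrt (real q) + 1 \<le> real q powr (2 / 3)) at_top"
    by (rule eventually_compose_filterlim[OF _ filterlim_real_sequentially])
  have "eventually (\<lambda>q. measure_pmf.prob (random_subset (plane (F q)) (real q powr a))
             {Q. real (max_arc (F q) Q) \<ge> real q * real q powr a * f (real q)} \<le> h (real q))
     (inf at_top (principal {q. primepow q}))"
    \<comment> \<open>The size conditions hold for all large \<open>q\<close>; being a prime power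
      becomes a premise, which supplies the field of order \<open>q\<close>.\<close>
    unfolding eventually_inf_principal using ev
  proof eventually_elim
    case (elim q)
    show ?case
    proof
      assume "q \<in> {q. primepow q}"
      then have pq: "primepow q" by simp
      then have q2: "q \<ge> 2" using primepow_gt_Suc_0[OF pq] by simp
      show "measure_pmf.prob (random_subset (plane (F q)) (real q powr a))
             {Q. real (max_arc (F q) Q) \<ge> real q * real q powr a * f (real q)} \<le> h (real q)"
        unfolding h_def
      proof (rule prob_max_arc_ge_le_exp)
        show "real q powr (- 1 / 3) \<le> real q powr a"
          using q2 assms(2) by (intro powr_mono) auto
        show "real q powr a \<le> 1"
          using q2 assms(3) powr_mono[of a 0 "real q"] by simp
      qed (use assms(1)[OF pq] elim q2 in auto)
    qed
  qed
  then show ?thesis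
    by (intro tendsto_sandwich[OF _ _ tendsto_const h]) auto
qed

end
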